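(* Let $G$ be a periodic group which is not locally finite, and let $A$ be an infinite set. Then there exists a bijective cellular automaton $\tau\colon A^G\to A^G$ which is not reversible. In fact, the same conclusion holds for every non-locally finite group $G$ (and every infinite set $A$), without assuming periodicity.
   Context: A group is periodic if each of its elements has finite order. A group $G$ is locally finite if every finitely generated subgroup of $G$ is finite. For a group $G$ and a nonempty set $A$, $A^G$ is the set of all maps $x\colon G\to A$, with the left shift action $(gx)(h)=x(g^{-1}h)$ for $g,h\in G$. A map $\tau\colon A^G\to A^G$ is a cellular automaton if there exist a finite subset $M\subset G$ (called a memory set for $\tau$) and a map $\mu\colon A^M\to A$ such that $\tau(x)(g)=\mu\bigl((g^{-1}x)|_M\bigr)$ for all $x\in A^G$ and $g\in G$. A bijective cellular automaton $\tau\colon A^G\to A^G$ is reversible if its inverse map $\tau^{-1}\colon A^G\to A^G$ is also a cellular automaton. *)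

theory Defs
  imports "HOL-Algebra.Multiplicative_Group"
begin

text \<open>\<open>group.ord G x = 0\<close> is the library's encoding of an element of infinite order.\<close>

definition periodic_group :: "('a, 'm) monoid_scheme \<Rightarrow> bool" where
  "periodic_group G \<longleftrightarrow> (\<forall>x \<in> carrier G. group.ord G x \<noteq> 0)"

definition finitely_generated_subgroup :: "'a set \<Rightarrow> ('a, 'm) monoid_scheme \<Rightarrow> bool" where
  "finitely_generated_subgroup H G \<longleftrightarrow>
     subgroup H G \<and> (\<exists>S. finite S \<and> S \<subseteq> carrier G \<and> H = generate G S)"

definition locally_finite_group :: "('a, 'm) monoid_scheme \<Rightarrow> bool" where
  "locally_finite_group G \<longleftrightarrow> (\<forall>H. finitely_generated_subgroup H G \<longrightarrow> finite H)"

text \<open>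
  The set \<open>A\<^sup>G\<close>. Maps with domain \<open>carrier G\<close> are represented by extensional functions, so that
  equality of configurations is equality of their values on \<open>carrier G\<close>.
\<close>

definition configurations :: "('a, 'm) monoid_scheme \<Rightarrow> 'b set \<Rightarrow> ('a \<Rightarrow> 'b) set" where
  "configurations G A = carrier G \<rightarrow>\<^sub>E A"

definition shift :: "('a, 'm) monoid_scheme \<Rightarrow> 'a \<Rightarrow> ('a \<Rightarrow> 'b) \<Rightarrow> ('a \<Rightarrow> 'b)" where
  "shift G g x = (\<lambda>h \<in> carrier G. x (inv\<^bsub>G\<^esub> g \<otimes>\<^bsub>G\<^esub> h))"

text \<open>
  A self-map of \<open>A\<^sup>G\<close> is represented by a function whose values outside \<open>configurations G A\<close>
  are irrelevant to all of the following notions.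
\<close>

definition cellular_automaton ::
    "('a, 'm) monoid_scheme \<Rightarrow> 'b set \<Rightarrow> (('a \<Rightarrow> 'b) \<Rightarrow> ('a \<Rightarrow> 'b)) \<Rightarrow> bool" where
  "cellular_automaton G A \<tau> \<longleftrightarrow>
     \<tau> \<in> configurations G A \<rightarrow> configurations G A \<and>
     (\<exists>M \<mu>. finite M \<and> M \<subseteq> carrier G \<and> \<mu> \<in> (M \<rightarrow>\<^sub>E A) \<rightarrow> A \<and>
        (\<forall>x \<in> configurations G A. \<forall>g \<in> carrier G.
           \<tau> x g = \<mu> (restrict (shift G (inv\<^bsub>G\<^esub> g) x) M)))"

definition bijective_cellular_automaton ::
    "('a, 'm) monoid_scheme \<Rightarrow> 'b set \<Rightarrow> (('a \<Rightarrow> 'b) \<Rightarrow> ('a \<Rightarrow> 'b)) \<Rightarrow> bool" where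
  "bijective_cellular_automaton G A \<tau> \<longleftrightarrow>
     cellular_automaton G A \<tau> \<and> bij_betw \<tau> (configurations G A) (configurations G A)"

definition reversible_cellular_automaton ::
    "('a, 'm) monoid_scheme \<Rightarrow> 'b set \<Rightarrow> (('a \<Rightarrow> 'b) \<Rightarrow> ('a \<Rightarrow> 'b)) \<Rightarrow> bool" where
  "reversible_cellular_automaton G A \<tau> \<longleftrightarrow>
     bijective_cellular_automaton G A \<tau> \<and>
     cellular_automaton G A (inv_into (configurations G A) \<tau>)"

end

theory Submission
  imports Defs
begin

text \<open>
  Let every symbol carry a level in \<open>\<nat>\<close> and, if it is one of a countable family, a bit, and let the
  automaton toggle the bit at \<open>g\<close> iff some neighbour \<open>g s\<close> has a strictly smaller level and its bit
  set. Levels never change, so the bits can be recovered by recursion on the level, and the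
  automaton is bijective. The recursion, however, reaches arbitrarily far: on the infinite
  subgroup \<open>H\<close> generated by the neighbourhood, fix \<open>h \<in> H\<close> and let the level of \<open>g\<close> be the word
  length of \<open>g\<^sup>-\<^sup>1 h\<close>. The configuration on \<open>H\<close> with all bits set is sent to the one whose
  only set bit is at \<open>h\<close>, while the one without set bits is fixed. The inverse at \<open>\<one>\<close> therefore
  depends on the value at \<open>h\<close>, so \<open>h\<close> lies in every memory set of the inverse; but \<open>h \<in> H\<close> was
  arbitrary.
\<close>

text \<open>A shortest word for \<open>u\<close> in the letters of \<open>S\<close> and their
  inverses becomes shorter when its first letter is removed. Only this descent is exported, since it
  is all that the level function of the counterexample needs.\<close>

lemma (in group) ex_word_length:
  assumes "S \<subseteq> carrier G"
  obtains len :: "'a \<Rightarrow> nat" where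
    "\<And>u. u \<in> generate G S \<Longrightarrow> u \<noteq> \<one> \<Longrightarrow>
           \<exists>s \<in> S \<union> m_inv G ` S. \<exists>v \<in> generate G S. u = s \<otimes> v \<and> len v < len u"
proof -
  \<comment> \<open>Edges of the left Cayley graph. A word for \<open>u\<close> is a path from
    \<one> to \<open>u\<close>, and its first letter is the last edge.\<close>
  define R where "R = {(v, s \<otimes> v) |s v. s \<in> S \<union> m_inv G ` S \<and> v \<in> generate G S}"
  \<comment> \<open>An arbitrary starting point \<open>v\<close> lets the product case concatenate
    the path for \<open>b\<close> with the path for \<open>a\<close>.\<close>
  have reach: "(v, u \<otimes> v) \<in> R\<^sup>*" if "u \<in> generate G S" "v \<in> generate G S" for u v
    using that
  proof (induction arbitrary: v rule: generate.induct)
    case one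
    then show ?case using generate_in_carrier[OF assms] by simp
  next
    case (incl s)
    then show ?case unfolding R_def by (intro r_into_rtrancl) auto
  next
    case (inv s)
    then show ?case unfolding R_def by (intro r_into_rtrancl) auto
  next
    case (eng a b)
    have "(v, b \<otimes> v) \<in> R\<^sup>*" "(b \<otimes> v, a \<otimes> (b \<otimes> v)) \<in> R\<^sup>*"
      using eng by (auto intro: generate.eng)
    moreover have "a \<otimes> (b \<otimes> v) = a \<otimes> b \<otimes> v"
      using eng generate_in_carrier[OF assms] by (simp add: m_assoc)
    ultimately show ?case by simp
  qed
  define len where "len u = (LEAST n. (\<one>, u) \<in> R ^^ n)" for u
  show thesis
  proof
    fix u assume u: "u \<in> generate G S" "u \<noteq> \<one>"
    have "(\<one>, u) \<in> R\<^sup>*"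
      using reach[OF u(1) generate.one] u(1) generate_in_carrier[OF assms] by simp
    then have "\<exists>n. (\<one>, u) \<in> R ^^ n" by (rule rtrancl_imp_relpow)
    then have "(\<one>, u) \<in> R ^^ len u" unfolding len_def by (rule LeastI_ex)
    with u(2) obtain m where m: "len u = Suc m" "(\<one>, u) \<in> R ^^ Suc m"
      by (cases "len u") auto
    from m(2) obtain v where v: "(\<one>, v) \<in> R ^^ m" "(v, u) \<in> R"
      by (rule relpow_Suc_E)
    from v(1) have "len v \<le> m" unfolding len_def by (rule Least_le)
    with m(1) v(2) show "\<exists>s \<in> S \<union> m_inv G ` S. \<exists>v \<in> generate G S. u = s \<otimes> v \<and> len v < len u"
      unfolding R_def by fastforce
  qed
qed

text \<open>A copy of the naturals inside \<open>A\<close> is cut into pairs 2n, 2n+1. Both members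
  have level n, \<open>F\<close> swaps them, and the even one, \<open>c n\<close>, has its bit set.
  All other symbols are fixed by \<open>F\<close>, so their unspecified levels and bits do no
  harm.\<close>

lemma infinite_ex_levels:
  fixes A :: "'b set"
  assumes "infinite A"
  obtains F :: "'b \<Rightarrow> 'b" and L :: "'b \<Rightarrow> nat" and c :: "nat \<Rightarrow> 'b" and B :: "'b \<Rightarrow> bool"
  where "F \<in> A \<rightarrow> A" "\<And>a. F (F a) = a" "\<And>a. L (F a) = L a"
    "\<And>n. c n \<in> A" "\<And>n. L (c n) = n" "\<And>n. B (c n)" "\<And>n. \<not> B (F (c n))"
proof -
  obtain f :: "nat \<Rightarrow> 'b" where f: "inj f" "range f \<subseteq> A"
    using infinite_countable_subset[OF assms] by blast
  define t :: "nat \<Rightarrow> nat" where "t k = (if even k then Suc k else k - 1)" for k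
  have t: "t (t k) = k" "t k div 2 = k div 2" "even (t k) \<longleftrightarrow> odd k" for k
    unfolding t_def by (auto elim!: oddE)
  define i where "i = the_inv f"
  have i [simp]: "i (f k) = k" for k
    unfolding i_def using f(1) by (rule the_inv_f_f)
  define F where "F a = (if a \<in> range f then f (t (i a)) else a)" for a
  show thesis
  proof
    show "F \<in> A \<rightarrow> A" using range_subsetD[OF f(2)] by (auto simp: F_def)
    show "F (F a) = a" for a by (auto simp: F_def t)
    show "i (F a) div 2 = i a div 2" for a by (auto simp: F_def t)
    show "f (2 * n) \<in> A" for n using f(2) by auto
    show "i (f (2 * n)) div 2 = n" "even (i (f (2 * n)))" for n by simp_all
    show "\<not> even (i (F (f (2 * n))))" for n by (simp add: F_def t)
  qed
qed

locale level_flip = group G for G :: "('a, 'm) monoid_scheme" (structure) +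
  fixes A :: "'b set" and T :: "'a set"
    and L :: "'b \<Rightarrow> nat" and B :: "'b \<Rightarrow> bool" and F :: "'b \<Rightarrow> 'b"
  assumes finite_T: "finite T" and T_carrier: "T \<subseteq> carrier G"
    and F_closed: "F \<in> A \<rightarrow> A" and F_F [simp]: "F (F a) = a" and L_F [simp]: "L (F a) = L a"
begin

definition trigger :: "('a \<Rightarrow> 'b) \<Rightarrow> 'a \<Rightarrow> bool" where
  "trigger x g \<longleftrightarrow> (\<exists>s \<in> T. L (x (g \<otimes> s)) < L (x g) \<and> B (x (g \<otimes> s)))"

definition flip :: "('a \<Rightarrow> 'b) \<Rightarrow> 'a \<Rightarrow> 'b" where
  "flip x = (\<lambda>g \<in> carrier G. if trigger x g then F (x g) else x g)"

lemma flip_apply: "g \<in> carrier G \<Longrightarrow> flip x g = (if trigger x g then F (x g) else x g)"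
  by (simp add: flip_def)

lemma L_flip: "g \<in> carrier G \<Longrightarrow> L (flip x g) = L (x g)"
  by (simp add: flip_apply)

lemma flip_closed: "x \<in> configurations G A \<Longrightarrow> flip x \<in> configurations G A"
  using Pi_mem[OF F_closed] PiE_mem[of x "carrier G" "\<lambda>_. A"]
  by (auto simp: flip_def configurations_def)

text \<open>Whether a cell is triggered depends on levels and on the symbols at neighbours of
  strictly smaller level. This locality drives both inductions on the level below.\<close>

lemma trigger_cong:
  assumes "L (x g) = L (x' g)"
    and "\<And>s. s \<in> T \<Longrightarrow> L (x (g \<otimes> s)) = L (x' (g \<otimes> s))"
    and "\<And>s. s \<in> T \<Longrightarrow> L (x (g \<otimes> s)) < L (x g) \<Longrightarrow> x (g \<otimes> s) = x' (g \<otimes> s)"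
  shows "trigger x g \<longleftrightarrow> trigger x' g"
  unfolding trigger_def using assms by metis

lemma cellular_automaton_flip: "cellular_automaton G A flip"
proof -
  \<comment> \<open>The window entry \<open>w s\<close> stands for \<open>x (g \<otimes> s)\<close>,
    so the cell's own symbol is read at \<one>.\<close>
  define \<mu> where "\<mu> w = (if \<exists>s \<in> T. L (w s) < L (w \<one>) \<and> B (w s) then F (w \<one>) else w \<one>)"
    for w :: "'a \<Rightarrow> 'b"
  have "\<mu> \<in> (insert \<one> T \<rightarrow>\<^sub>E A) \<rightarrow> A"
    using Pi_mem[OF F_closed] PiE_mem[of _ "insert \<one> T" "\<lambda>_. A"]
    by (auto simp: \<mu>_def)
  moreover have "flip x g = \<mu> (restrict (shift G (inv g) x) (insert \<one> T))"
    if "g \<in> carrier G" for x g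
  proof -
    have "restrict (shift G (inv g) x) (insert \<one> T) s = x (g \<otimes> s)" if "s \<in> insert \<one> T" for s
      using that \<open>g \<in> carrier G\<close> T_carrier by (auto simp: shift_def)
    then show ?thesis
      using that by (auto simp: \<mu>_def flip_apply trigger_def)
  qed
  ultimately show ?thesis
    unfolding cellular_automaton_def using finite_T T_carrier flip_closed
    by (intro conjI exI[of _ "insert \<one> T"] exI[of _ \<mu>]) auto
qed

text \<open>The common image determines all levels. By induction on the level the triggers agree
  too, and the involution \<open>F\<close> cancels.\<close>

lemma inj_on_flip: "inj_on flip (configurations G A)"
proof (rule inj_onI)
  fix x x' assume x: "x \<in> configurations G A" "x' \<in> configurations G A" "flip x = flip x'"
  have L: "L (x g) = L (x' g)" if "g \<in> carrier G" for g
    using L_flip[OF that] x(3) by metis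
  have "x g = x' g" if "g \<in> carrier G" for g
    using that
  proof (induction "L (x g)" arbitrary: g rule: less_induct)
    case less
    have "trigger x g \<longleftrightarrow> trigger x' g"
      using less T_carrier by (intro trigger_cong L) auto
    then show ?case
      using fun_cong[OF x(3), of g] flip_apply[OF less.prems] F_F by metis
  qed
  then show "x = x'"
    using x(1,2) unfolding configurations_def by (metis PiE_ext)
qed

lemma ex_flip_eq:
  assumes y: "y \<in> configurations G A"
  shows "\<exists>x \<in> configurations G A. flip x = y"
proof -
  \<comment> \<open>Since \<open>F\<close> is an involution, the preimages of \<open>y\<close> are
    the fixed points of \<Phi>. One is built as the pointwise limit of the iterates
    \<open>X n\<close>, all of which have the levels of \<open>y\<close>.\<close>
  define \<Phi> where "\<Phi> x = (\<lambda>g \<in> carrier G. if trigger x g then F (y g) else y g)" for x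
  define X where "X n = (\<Phi> ^^ n) y" for n
  have X_Suc: "X (Suc n) g = (if trigger (X n) g then F (y g) else y g)"
    if "g \<in> carrier G" for n g
    using that by (simp add: X_def \<Phi>_def)
  have L_X: "L (X n g) = L (y g)" if "g \<in> carrier G" for n g
    using that by (cases n) (simp add: X_def, simp add: X_Suc)
  \<comment> \<open>Cells of level 0 are never triggered. A cell of level at most n+1 consults only
    symbols of level at most n, which have settled by iterate n.\<close>
  have step: "X n g = X (Suc n) g" if "L (y g) \<le> n" "g \<in> carrier G" for n g
    using that
  proof (induction n arbitrary: g)
    case 0
    then show ?case by (simp add: X_Suc trigger_def L_X) (simp add: X_def)
  next
    case (Suc n)
    have "trigger (X n) g \<longleftrightarrow> trigger (X (Suc n)) g"
      using Suc T_carrier by (intro trigger_cong) (auto simp: L_X subset_iff)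
    then show ?case using Suc.prems(2) X_Suc by simp
  qed
  have stable: "X m g = X (L (y g)) g" if "L (y g) \<le> m" "g \<in> carrier G" for m g
    using that by (induction m rule: dec_induct) (auto simp: step[symmetric])
  define x where "x = (\<lambda>g \<in> carrier G. X (L (y g)) g)"
  have A: "X n g \<in> A" if "g \<in> carrier G" for n g
  proof -
    have "y g \<in> A" using y that by (auto simp: configurations_def)
    then show ?thesis using that F_closed by (cases n) (auto simp: X_Suc, simp add: X_def)
  qed
  have "flip x g = y g" if g: "g \<in> carrier G" for g
  proof -
    let ?n = "L (y g)"
    have x_g: "x g = (if trigger (X ?n) g then F (y g) else y g)"
      using g step[of g ?n] X_Suc[of g ?n] by (simp add: x_def)
    \<comment> \<open>The neighbours of \<open>g\<close> of level below \<open>?n\<close> have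
      already reached their limit values in \<open>X ?n\<close>.\<close>
    have "trigger (X ?n) g \<longleftrightarrow> trigger x g"
    proof (rule trigger_cong)
      fix s assume s: "s \<in> T"
      then have gs: "g \<otimes> s \<in> carrier G" using g T_carrier by auto
      then show "L (X ?n (g \<otimes> s)) = L (x (g \<otimes> s))" by (simp add: x_def L_X)
      assume "L (X ?n (g \<otimes> s)) < L (X ?n g)"
      then show "X ?n (g \<otimes> s) = x (g \<otimes> s)"
        using stable[of "g \<otimes> s" ?n] g gs by (simp add: x_def L_X)
    qed (use g in \<open>simp add: x_def\<close>)
    then show ?thesis using x_g by (simp add: flip_apply[OF g])
  qed
  then have "flip x = y"
    using y by (auto simp: flip_def configurations_def PiE_def extensional_def fun_eq_iff)
  moreover have "x \<in> configurations G A"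
    using A by (auto simp: x_def configurations_def)
  ultimately show ?thesis by blast
qed

lemma bijective_flip: "bijective_cellular_automaton G A flip"
  unfolding bijective_cellular_automaton_def bij_betw_def
  using cellular_automaton_flip inj_on_flip flip_closed ex_flip_eq by (auto simp: image_iff)

end

text \<open>At the identity the shift is trivial, so the inverse reads the image directly on its
  memory set \<open>N\<close>. To refute reversibility it suffices to defeat every finite
  \<open>N\<close> by two configurations that differ at the identity.\<close>

lemma inverse_memory_set_agree:
  assumes "group G" "reversible_cellular_automaton G A \<tau>"
  obtains N where "finite N"
    and "\<And>x x'. x \<in> configurations G A \<Longrightarrow> x' \<in> configurations G A \<Longrightarrow>
           (\<forall>n \<in> N. \<tau> x n = \<tau> x' n) \<Longrightarrow> x \<one>\<^bsub>G\<^esub> = x' \<one>\<^bsub>G\<^esub>"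
proof -
  interpret group G by fact
  let ?C = "configurations G A"
  have bij: "bij_betw \<tau> ?C ?C" and ca: "cellular_automaton G A (inv_into ?C \<tau>)"
    using assms(2)
    by (auto simp: reversible_cellular_automaton_def bijective_cellular_automaton_def)
  from ca obtain N \<nu> where N: "finite N" "N \<subseteq> carrier G"
    and \<nu>: "\<And>y g. y \<in> ?C \<Longrightarrow> g \<in> carrier G \<Longrightarrow>
        inv_into ?C \<tau> y g = \<nu> (restrict (shift G (inv\<^bsub>G\<^esub> g) y) N)"
    unfolding cellular_automaton_def by auto
  have eval: "x \<one>\<^bsub>G\<^esub> = \<nu> (restrict (\<tau> x) N)" if "x \<in> ?C" for x
  proof -
    have "inv_into ?C \<tau> (\<tau> x) = x"
      using bij that by (simp add: bij_betw_def)
    moreover have "\<tau> x \<in> ?C" using bij that by (auto simp: bij_betw_def)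
    moreover have "restrict (shift G (inv\<^bsub>G\<^esub> \<one>\<^bsub>G\<^esub>) (\<tau> x)) N = restrict (\<tau> x) N"
      using N(2) by (intro restrict_ext) (auto simp: shift_def)
    ultimately show ?thesis using \<nu>[of "\<tau> x" "\<one>\<^bsub>G\<^esub>"] by simp
  qed
  show thesis
  proof (rule that[OF N(1)])
    fix x x' assume "x \<in> ?C" "x' \<in> ?C" "\<forall>n \<in> N. \<tau> x n = \<tau> x' n"
    then show "x \<one>\<^bsub>G\<^esub> = x' \<one>\<^bsub>G\<^esub>"
      by (simp add: eval cong: restrict_cong)
  qed
qed

lemma ex_bijective_not_reversible:
  fixes G :: "('a, 'm) monoid_scheme" and A :: "'b set"
  assumes "group G" "\<not> locally_finite_group G" "infinite A"
  shows "\<exists>\<tau>. bijective_cellular_automaton G A \<tau> \<and> \<not> reversible_cellular_automaton G A \<tau>"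
proof -
  interpret group G by fact
  obtain S where S: "finite S" "S \<subseteq> carrier G" "infinite (generate G S)"
    using assms(2)
    by (auto simp: locally_finite_group_def finitely_generated_subgroup_def)
  define T where "T = S \<union> m_inv G ` S"
  define H where "H = generate G S"
  have subH: "subgroup H G" unfolding H_def using S(2) by (rule generate_is_subgroup)
  have H_carrier: "H \<subseteq> carrier G" using subH by (rule subgroup.subset)
  have T_carrier: "T \<subseteq> carrier G" using S(2) by (auto simp: T_def)
  obtain len :: "'a \<Rightarrow> nat" where len:
    "\<And>u. u \<in> H \<Longrightarrow> u \<noteq> \<one>\<^bsub>G\<^esub> \<Longrightarrow> \<exists>s \<in> T. \<exists>v \<in> H. u = s \<otimes>\<^bsub>G\<^esub> v \<and> len v < len u"
    using ex_word_length[OF S(2)] unfolding T_def H_def by blast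
  obtain F and L :: "'b \<Rightarrow> nat" and c B where F: "F \<in> A \<rightarrow> A" "\<And>a. F (F a) = a" "\<And>a. L (F a) = L a"
    and c: "\<And>n. c n \<in> A" "\<And>n. L (c n) = n" "\<And>n. B (c n)" "\<And>n. \<not> B (F (c n))"
    by (rule infinite_ex_levels[OF assms(3)]) (rule that)
  interpret level_flip G A T L B F
    using S(1) T_carrier F by unfold_locales (auto simp: T_def)
  have "\<not> reversible_cellular_automaton G A flip"
  proof
    assume "reversible_cellular_automaton G A flip"
    then obtain N where N: "finite N" "\<And>x x'. x \<in> configurations G A \<Longrightarrow> x' \<in> configurations G A \<Longrightarrow>
        (\<forall>n \<in> N. flip x n = flip x' n) \<Longrightarrow> x \<one>\<^bsub>G\<^esub> = x' \<one>\<^bsub>G\<^esub>"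
      using inverse_memory_set_agree[OF assms(1)] by blast
    obtain h where h: "h \<in> H" "h \<notin> N"
      using N(1) S(3) unfolding H_def by (meson finite_subset subsetI)
    \<comment> \<open>Right multiplication of \<open>g\<close> by the first letter of
      \<open>inv g \<otimes> h\<close> removes that letter, so \<open>d\<close> descends towards
      \<open>h\<close> along the neighbours that \<open>flip\<close> inspects.\<close>
    define d where "d g = len (inv\<^bsub>G\<^esub> g \<otimes>\<^bsub>G\<^esub> h)" for g
    have descent: "\<exists>s \<in> T. g \<otimes>\<^bsub>G\<^esub> s \<in> H \<and> d (g \<otimes>\<^bsub>G\<^esub> s) < d g" if g: "g \<in> H" "g \<noteq> h" for g
    proof -
      have gc: "g \<in> carrier G" "h \<in> carrier G" using g(1) h(1) H_carrier by auto
      have "inv\<^bsub>G\<^esub> g \<otimes>\<^bsub>G\<^esub> h \<in> H"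
        using subH g(1) h(1) by (simp add: subgroup.m_closed subgroup.m_inv_closed)
      moreover have "inv\<^bsub>G\<^esub> g \<otimes>\<^bsub>G\<^esub> h \<noteq> \<one>\<^bsub>G\<^esub>"
        using g(2) gc by (metis inv_closed inv_equality inv_inv)
      ultimately obtain s v where sv: "s \<in> T" "v \<in> H" "inv\<^bsub>G\<^esub> g \<otimes>\<^bsub>G\<^esub> h = s \<otimes>\<^bsub>G\<^esub> v"
        "len v < len (inv\<^bsub>G\<^esub> g \<otimes>\<^bsub>G\<^esub> h)"
        using len by blast
      have sc: "s \<in> carrier G" "v \<in> carrier G" using sv T_carrier H_carrier by auto
      have "s \<in> H"
        using sv(1) subH unfolding T_def H_def by (auto intro: generate.incl generate.inv)
      then have "g \<otimes>\<^bsub>G\<^esub> s \<in> H" using subH g(1) by (simp add: subgroup.m_closed)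
      moreover have "inv\<^bsub>G\<^esub> (g \<otimes>\<^bsub>G\<^esub> s) \<otimes>\<^bsub>G\<^esub> h = inv\<^bsub>G\<^esub> s \<otimes>\<^bsub>G\<^esub> (s \<otimes>\<^bsub>G\<^esub> v)"
        using gc sc sv(3) by (simp add: inv_mult_group m_assoc)
      then have "d (g \<otimes>\<^bsub>G\<^esub> s) = len v"
        using sc by (simp add: d_def m_assoc[symmetric])
      ultimately show ?thesis using sv(1,4) by (auto simp: d_def)
    qed
    \<comment> \<open>All bits are clear in \<open>x\<close> and set in \<open>x'\<close> on
      \<open>H\<close>. Outside \<open>H\<close>, the clear bit keeps \<open>x\<close> free of
      triggers, and level 0 keeps these cells untriggered in \<open>x'\<close> as well.\<close>
    define x where "x = (\<lambda>g \<in> carrier G. if g \<in> H then F (c (d g)) else F (c 0))"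
    define x' where "x' = (\<lambda>g \<in> carrier G. if g \<in> H then c (d g) else F (c 0))"
    have conf: "x \<in> configurations G A" "x' \<in> configurations G A"
      using Pi_mem[OF F(1)] c(1) by (auto simp: x_def x'_def configurations_def)
    have "flip x g = flip x' g" if gh: "g \<noteq> h" for g
    proof (cases "g \<in> carrier G")
      case g: True
      have gT: "g \<otimes>\<^bsub>G\<^esub> s \<in> carrier G" if "s \<in> T" for s
        using that g T_carrier by auto
      have "\<not> trigger x g"
        using gT c(4) by (auto simp: trigger_def x_def)
      then have x_g: "flip x g = x g" using g by (simp add: flip_apply)
      show ?thesis
      proof (cases "g \<in> H")
        case True
        obtain s where s: "s \<in> T" "g \<otimes>\<^bsub>G\<^esub> s \<in> H" "d (g \<otimes>\<^bsub>G\<^esub> s) < d g"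
          using descent[OF True gh] by blast
        \<comment> \<open>The descending neighbour has its bit set in \<open>x'\<close>, so
          \<open>flip\<close> turns \<open>c (d g)\<close> into \<open>F (c (d g))\<close>, the
          value of \<open>x\<close>.\<close>
        then have "trigger x' g"
          unfolding trigger_def using True g gT c by (intro bexI[of _ s]) (auto simp: x'_def)
        then show ?thesis using x_g True g by (simp add: flip_apply x_def x'_def)
      next
        case False
        then have "\<not> trigger x' g" using g c(2) by (auto simp: trigger_def x'_def)
        then show ?thesis using x_g False g by (simp add: flip_apply x_def x'_def)
      qed
    qed (simp add: flip_def)
    then have "x \<one>\<^bsub>G\<^esub> = x' \<one>\<^bsub>G\<^esub>" using N(2) conf h(2) by metis
    moreover have "\<one>\<^bsub>G\<^esub> \<in> H" using subH by (rule subgroup.one_closed)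
    \<comment> \<open>The two values at the identity are \<open>F (c n)\<close> and
      \<open>c n\<close> for the same n, which \<open>B\<close> tells apart.\<close>
    ultimately show False using c(3,4) by (simp add: x_def x'_def) metis
  qed
  then show ?thesis using bijective_flip by blast
qed

theorem corollary6p1:
  fixes G :: "('a, 'm) monoid_scheme" and A :: "'b set"
  assumes "group G"
    and "\<not> locally_finite_group G"
    and "infinite A"
  shows "(periodic_group G \<longrightarrow>
            (\<exists>\<tau>. bijective_cellular_automaton G A \<tau> \<and> \<not> reversible_cellular_automaton G A \<tau>)) \<and>
         (\<exists>\<tau>. bijective_cellular_automaton G A \<tau> \<and> \<not> reversible_cellular_automaton G A \<tau>)"
  using ex_bijective_not_reversible[OF assms] by blast

end
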